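(* Let $X\in\mathbb{R}^{n\times n}$ be a symmetric positive semidefinite matrix, let $r\ge 1$ and $\lambda>0$. Let $(U^\star,V^\star)\in\mathbb{R}^{n\times r}\times\mathbb{R}^{n\times r}$ be any critical point of $$\min_{U,V\in\mathbb{R}^{n\times r}} f(U,V)=\tfrac12\|X-UV^{T}\|_F^2+\tfrac{\lambda}{2}\|U-V\|_F^2+\delta_+(U)+\delta_+(V)$$ satisfying $\|U^\star V^{\star T}\|<2\lambda+\sigma_n(X)$. Then $U^\star=V^\star$, and $U^\star$ is a critical point of the symmetric nonnegative matrix factorization problem $$\min_{U\in\mathbb{R}^{n\times r}}\tfrac12\|X-UU^{T}\|_F^2\quad\text{subject to } U\ge 0 .$$
   Context: Matrix inequalities such as $U\ge 0$ are entrywise. $\|\cdot\|$ is the spectral norm, $\|\cdot\|_F$ the Frobenius norm, and $\sigma_n(X)$ is the $n$-th largest (i.e. smallest) singular value of $X$. $\delta_+$ is the indicator function of the nonnegative orthant: $\delta_+(U)=0$ if $U\ge0$ and $+\infty$ otherwise. $\partial\delta_+(U)$ is its convex subdifferential, $\{S\in\mathbb{R}^{n\times r}:\delta_+(U')\ge\delta_+(U)+\langle S,U'-U\rangle\ \forall U'\}$ if $U\ge0$, and $\emptyset$ otherwise. A critical point of $f$ is a pair $(U,V)$ with $0\in\partial_U f(U,V)$ and $0\in\partial_V f(U,V)$, where $\partial_U f(U,V)=(UV^T-X)V+\lambda(U-V)+\partial\delta_+(U)$ and $\partial_V f(U,V)=(UV^T-X)^TU-\lambda(U-V)+\partial\delta_+(V)$.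 A critical point of the symmetric problem is a $U$ with $0\in (UU^T-X)U+\partial\delta_+(U)$ (equivalently $0$ lies in the subdifferential of $\frac12\|X-UU^T\|_F^2+\delta_+(U)$, as $\partial\delta_+(U)$ is a cone). *)

theory Defs
  imports "HOL-Analysis.Analysis"
begin

text \<open>
  A matrix with \<open>n\<close> rows and \<open>r\<close> columns has type \<^typ>\<open>real ^ 'r ^ 'n\<close>.  On this type the
  library's \<^term>\<open>norm\<close> and inner product are the Frobenius norm and the Frobenius (trace) inner
  product.
\<close>

definition spectral_norm :: "real ^ 'm ^ 'n \<Rightarrow> real" where
  "spectral_norm A = onorm ((*v) A)"

definition singular_values :: "real ^ 'n ^ 'n \<Rightarrow> real set" where
  "singular_values A =
     {sqrt \<mu> | \<mu>. \<exists>v. v \<noteq> 0 \<and> (transpose A ** A) *v v = \<mu> *\<^sub>R v}"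

text \<open>
  Multiplicities are irrelevant for the smallest of the \<open>n\<close> singular values of an
  \<open>n \<times> n\<close> matrix, i.e. the \<open>n\<close>-th largest one.
\<close>

definition sigma_min :: "real ^ 'n ^ 'n \<Rightarrow> real" where
  "sigma_min A = Min (singular_values A)"

definition nonneg_mat :: "real ^ 'r ^ 'n \<Rightarrow> bool" where
  "nonneg_mat U \<longleftrightarrow> (\<forall>i j. 0 \<le> U $ i $ j)"

definition delta_plus :: "real ^ 'r ^ 'n \<Rightarrow> ereal" where
  "delta_plus U = (if nonneg_mat U then 0 else \<infinity>)"

definition subdiff_delta_plus :: "real ^ 'r ^ 'n \<Rightarrow> (real ^ 'r ^ 'n) set" where
  "subdiff_delta_plus U =
     (if nonneg_mat U
      then {S. \<forall>U'. delta_plus U' \<ge> delta_plus U + ereal (S \<bullet> (U' - U))}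
      else {})"

definition nmf_smooth :: "real ^ 'n ^ 'n \<Rightarrow> real \<Rightarrow> real ^ 'r ^ 'n \<Rightarrow> real ^ 'r ^ 'n \<Rightarrow> real" where
  "nmf_smooth X lam U V =
     1/2 * (norm (X - U ** transpose V))\<^sup>2 + lam/2 * (norm (U - V))\<^sup>2"

definition nmf_obj :: "real ^ 'n ^ 'n \<Rightarrow> real \<Rightarrow> real ^ 'r ^ 'n \<Rightarrow> real ^ 'r ^ 'n \<Rightarrow> ereal" where
  "nmf_obj X lam U V = ereal (nmf_smooth X lam U V) + delta_plus U + delta_plus V"

text \<open>
  The partial subdifferentials of \<^const>\<open>nmf_obj\<close>: a partial gradient of \<^const>\<open>nmf_smooth\<close>
  plus the subdifferential of the indicator function.
\<close>

definition partial_U :: "real ^ 'n ^ 'n \<Rightarrow> real \<Rightarrow> real ^ 'r ^ 'n \<Rightarrow> real ^ 'r ^ 'n \<Rightarrow> (real ^ 'r ^ 'n) set" where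
  "partial_U X lam U V =
     {(U ** transpose V - X) ** V + lam *\<^sub>R (U - V) + S | S. S \<in> subdiff_delta_plus U}"

definition partial_V :: "real ^ 'n ^ 'n \<Rightarrow> real \<Rightarrow> real ^ 'r ^ 'n \<Rightarrow> real ^ 'r ^ 'n \<Rightarrow> (real ^ 'r ^ 'n) set" where
  "partial_V X lam U V =
     {transpose (U ** transpose V - X) ** U - lam *\<^sub>R (U - V) + S | S. S \<in> subdiff_delta_plus V}"

definition critical_point :: "real ^ 'n ^ 'n \<Rightarrow> real \<Rightarrow> real ^ 'r ^ 'n \<Rightarrow> real ^ 'r ^ 'n \<Rightarrow> bool" where
  "critical_point X lam U V \<longleftrightarrow> 0 \<in> partial_U X lam U V \<and> 0 \<in> partial_V X lam U V"

text \<open>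
  For symmetric \<open>X\<close> the gradient of \<open>1/2 * (norm (X - U ** transpose U))\<^sup>2\<close> is
  \<open>2 * (U ** transpose U - X) ** U\<close>; the factor is dropped because the subdifferential of
  \<^const>\<open>delta_plus\<close> is a cone.
\<close>

definition sym_critical_point :: "real ^ 'n ^ 'n \<Rightarrow> real ^ 'r ^ 'n \<Rightarrow> bool" where
  "sym_critical_point X U \<longleftrightarrow>
     0 \<in> {(U ** transpose U - X) ** U + S | S. S \<in> subdiff_delta_plus U}"

lemma inner_mult_transpose:
  fixes A :: "real ^ 'm ^ 'n" and H :: "real ^ 'r ^ 'n" and V :: "real ^ 'r ^ 'm"
  shows "A \<bullet> (H ** transpose V) = H \<bullet> (A ** V)"
proof -
  have "A \<bullet> (H ** transpose V) = (\<Sum>i\<in>UNIV. \<Sum>j\<in>UNIV. \<Sum>k\<in>UNIV. A $ i $ j * (H $ i $ k * V $ j $ k))"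
    by (simp add: inner_vec_def matrix_matrix_mult_def transpose_def sum_distrib_left)
  also have "\<dots> = (\<Sum>i\<in>UNIV. \<Sum>k\<in>UNIV. \<Sum>j\<in>UNIV. A $ i $ j * (H $ i $ k * V $ j $ k))"
    by (rule sum.cong[OF refl], rule sum.swap)
  also have "\<dots> = H \<bullet> (A ** V)"
    by (simp add: inner_vec_def matrix_matrix_mult_def sum_distrib_left mult_ac)
  finally show ?thesis .
qed

lemma inner_transpose_transpose:
  fixes A B :: "real ^ 'm ^ 'n"
  shows "transpose A \<bullet> transpose B = A \<bullet> B"
  by (simp add: inner_vec_def transpose_def) (rule sum.swap)

lemma nmf_smooth_commute: "nmf_smooth X lam U V = nmf_smooth (transpose X) lam V U"
proof -
  have "norm (X - U ** transpose V) = norm (transpose (X - U ** transpose V))"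
    by (simp add: norm_eq_sqrt_inner inner_transpose_transpose)
  also have "transpose (X - U ** transpose V) = transpose X - V ** transpose U"
    by (simp add: transpose_def vec_eq_iff matrix_matrix_mult_def mult.commute)
  finally show ?thesis
    by (simp add: nmf_smooth_def norm_minus_commute)
qed

lemma gradient_nmf_smooth_U:
  fixes X :: "real ^ 'n ^ 'n" and U V :: "real ^ 'r ^ 'n"
  shows "GDERIV (\<lambda>U. nmf_smooth X lam U V) U :> (U ** transpose V - X) ** V + lam *\<^sub>R (U - V)"
proof -
  have lin: "linear (\<lambda>H. H ** transpose V)"
    by (rule linearI) (simp_all add: matrix_matrix_mult_def vec_eq_iff sum.distrib
        sum_distrib_left algebra_simps)
  have d: "((\<lambda>H. H ** transpose V) has_derivative (\<lambda>H. H ** transpose V)) (at U)"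
    by (rule bounded_linear_imp_has_derivative[OF linear_conv_bounded_linear[THEN iffD1, OF lin]])
  have sq: "((\<lambda>U. (norm (g U))\<^sup>2) has_derivative (\<lambda>H. 2 * (g U \<bullet> g' H))) (at U)"
    if "(g has_derivative g') (at U)" for g g' :: "real ^ 'r ^ 'n \<Rightarrow> 'b::real_inner"
    using has_derivative_inner[OF that that]
    by (simp add: power2_norm_eq_inner inner_commute)
  have "((\<lambda>U. X - U ** transpose V) has_derivative (\<lambda>H. 0 - H ** transpose V)) (at U)"
    by (rule has_derivative_diff[OF has_derivative_const d])
  note d1 = has_derivative_mult_right[OF sq[OF this], of "1/2"]
  have "((\<lambda>U. U - V) has_derivative (\<lambda>H. H - 0)) (at U)"
    by (rule has_derivative_diff[OF has_derivative_ident has_derivative_const])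
  note d2 = has_derivative_mult_right[OF sq[OF this], of "lam/2"]
  have "((\<lambda>U. nmf_smooth X lam U V) has_derivative
      (\<lambda>H. 1/2 * (2 * ((X - U ** transpose V) \<bullet> (0 - H ** transpose V))) + lam/2 * (2 * ((U - V) \<bullet> (H - 0))))) (at U)"
    unfolding nmf_smooth_def by (rule has_derivative_add[OF d1 d2])
  moreover have "1/2 * (2 * ((X - U ** transpose V) \<bullet> (0 - H ** transpose V))) + lam/2 * (2 * ((U - V) \<bullet> (H - 0)))
      = H \<bullet> ((U ** transpose V - X) ** V + lam *\<^sub>R (U - V))" for H
    using inner_mult_transpose[of "U ** transpose V - X" H V]
    by (simp add: inner_add_right inner_diff_left inner_commute[of H "U - V"])
  ultimately show ?thesis
    unfolding gderiv_def by simp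
qed

lemma gradient_nmf_smooth_V:
  fixes X :: "real ^ 'n ^ 'n" and U V :: "real ^ 'r ^ 'n"
  shows "GDERIV (\<lambda>V. nmf_smooth X lam U V) V :> transpose (U ** transpose V - X) ** U - lam *\<^sub>R (U - V)"
proof -
  have tr: "transpose (U ** transpose V - X) = V ** transpose U - transpose X"
    by (simp add: transpose_def vec_eq_iff matrix_matrix_mult_def mult.commute)
  have grad: "(V ** transpose U - transpose X) ** U + lam *\<^sub>R (V - U)
      = transpose (U ** transpose V - X) ** U - lam *\<^sub>R (U - V)"
    unfolding tr by (simp add: scaleR_diff_right)
  have comm: "(\<lambda>V. nmf_smooth X lam U V) = (\<lambda>V. nmf_smooth (transpose X) lam V U)"
    by (rule ext) (rule nmf_smooth_commute)
  show ?thesis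
    using gradient_nmf_smooth_U[of "transpose X" lam U V] unfolding grad comm .
qed

end

theory Submission
  imports Defs
begin

text \<open>
  Put \<open>D = U - V\<close> and \<open>W = U V\<^sup>T\<close>.  The subdifferential of the indicator is a normal cone, so
  pairing the two optimality conditions with \<open>V - U\<close> and \<open>U - V\<close> and adding gives
  \<open>\<langle>D, (W - X) V - (W - X)\<^sup>T U\<rangle> + 2 \<lambda> \<parallel>D\<parallel>\<^sub>F\<^sup>2 \<le> 0\<close>.  The exact identity
  \<open>\<langle>D, W V - W\<^sup>T U\<rangle> = \<parallel>W - W\<^sup>T\<parallel>\<^sub>F\<^sup>2 / 2 - \<langle>D, W D\<rangle>\<close> then yields
  \<open>(2 \<lambda> + \<sigma>\<^sub>n(X) - \<parallel>W\<parallel>) \<parallel>D\<parallel>\<^sub>F\<^sup>2 \<le> 0\<close>, hence \<open>D = 0\<close>.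
\<close>

text \<open>Otherwise a small step from \<open>v\<close> along \<open>- (B *v v)\<close> would make
  the form negative: the first-order decrease beats the second-order term.\<close>

lemma psd_form_zero_imp_kernel:
  fixes B :: "real ^ 'n ^ 'n"
  assumes sym: "transpose B = B" and psd: "\<And>x. 0 \<le> x \<bullet> (B *v x)" and zero: "v \<bullet> (B *v v) = 0"
  shows "B *v v = 0"
proof (rule ccontr)
  define w where "w = B *v v"
  define c where "c = w \<bullet> (B *v w)"
  assume "B *v v \<noteq> 0"
  then have pos: "0 < w \<bullet> w" by (simp add: w_def)
  have c0: "0 \<le> c" unfolding c_def by (rule psd)
  have vw: "v \<bullet> (B *v w) = w \<bullet> w"
    unfolding w_def by (metis dot_lmul_matrix sym transpose_matrix_vector)
  have q: "0 \<le> t * (t * c - 2 * (w \<bullet> w))" for t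
  proof -
    have "(v - t *\<^sub>R w) \<bullet> (B *v (v - t *\<^sub>R w)) = t * (t * c - 2 * (w \<bullet> w))"
      using zero vw
      by (simp add: c_def algebra_simps flip: w_def)
    then show ?thesis using psd by metis
  qed
  \<comment> \<open>Any positive \<open>t\<close> with \<open>t * c < 2 * (w \<bullet> w)\<close>
    works; the \<open>+ 1\<close> keeps the quotient defined when \<open>c = 0\<close>.\<close>
  define t where "t = (w \<bullet> w) / (c + 1)"
  have "t > 0" "t * c < 2 * (w \<bullet> w)"
    using pos c0 mult_nonneg_nonneg[OF c0, of "w \<bullet> w"]
    by (auto simp: t_def divide_simps algebra_simps intro: add_nonneg_pos)
  then have "t * (t * c - 2 * (w \<bullet> w)) < 0"
    by (simp add: mult_pos_neg)
  then show False using q[of t] by simp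
qed

text \<open>The form attains its minimum \<open>m\<close> on the compact unit sphere. Shifting by
  \<open>m\<close> times the identity gives a semidefinite form vanishing at the minimizer, so the
  kernel lemma makes the minimizer an eigenvector.\<close>

lemma symmetric_rayleigh_minimizer:
  fixes A :: "real ^ 'n ^ 'n"
  assumes sym: "transpose A = A"
  obtains v m where "v \<noteq> 0" "A *v v = m *\<^sub>R v" "\<And>x. m * (x \<bullet> x) \<le> x \<bullet> (A *v x)"
proof -
  have "\<exists>v\<in>sphere 0 1. \<forall>x\<in>sphere 0 1. v \<bullet> (A *v v) \<le> x \<bullet> (A *v x)"
    by (intro continuous_attains_inf continuous_intros matrix_vector_mult_linear_continuous_on) auto
  then obtain v where v: "norm v = 1" "\<And>x. norm x = 1 \<Longrightarrow> v \<bullet> (A *v v) \<le> x \<bullet> (A *v x)"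
    by auto
  define m where "m = v \<bullet> (A *v v)"
  have m: "m * (x \<bullet> x) \<le> x \<bullet> (A *v x)" for x
  proof (cases "x = 0")
    case False
    have "m \<le> (inverse (norm x) *\<^sub>R x) \<bullet> (A *v (inverse (norm x) *\<^sub>R x))"
      unfolding m_def using False by (intro v(2)) simp
    also have "\<dots> = (x \<bullet> (A *v x)) / (x \<bullet> x)"
      by (simp add: matrix_vector_mult_scaleR divide_simps dot_square_norm power2_eq_square)
    finally show ?thesis using False by (simp add: pos_le_divide_eq)
  qed simp
  define B where "B = A - m *\<^sub>R mat 1"
  have Bv: "B *v x = A *v x - m *\<^sub>R x" for x
    by (simp add: B_def matrix_vector_mult_diff_rdistrib scaleR_matrix_vector_assoc[symmetric])
  have "transpose B = B"
    using sym by (simp add: B_def vec_eq_iff transpose_def mat_def)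
  moreover have "0 \<le> x \<bullet> (B *v x)" for x
    using m[of x] by (simp add: Bv inner_diff_right)
  moreover have "v \<bullet> (B *v v) = 0"
    using v(1) by (simp add: Bv inner_diff_right m_def dot_square_norm)
  ultimately have "B *v v = 0" by (rule psd_form_zero_imp_kernel)
  then have "A *v v = m *\<^sub>R v" by (simp add: Bv)
  moreover have "v \<noteq> 0" using v(1) by auto
  ultimately show ?thesis using m by (intro that)
qed

text \<open>Eigenvectors of distinct eigenvalues are orthogonal, hence independent, so there are
  only finitely many. Finiteness is what lets \<open>Min\<close> in \<open>sigma_min\<close> be a
  lower bound.\<close>

lemma finite_symmetric_eigenvalues:
  fixes A :: "real ^ 'n ^ 'n"
  assumes sym: "transpose A = A"
  shows "finite {\<mu>. \<exists>v. v \<noteq> 0 \<and> A *v v = \<mu> *\<^sub>R v}" (is "finite ?E")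
proof -
  define g where "g = (\<lambda>\<mu>. SOME v. v \<noteq> 0 \<and> A *v v = \<mu> *\<^sub>R v)"
  have g: "g \<mu> \<noteq> 0" "A *v g \<mu> = \<mu> *\<^sub>R g \<mu>" if "\<mu> \<in> ?E" for \<mu>
    using that someI_ex[of "\<lambda>v. v \<noteq> 0 \<and> A *v v = \<mu> *\<^sub>R v"] unfolding g_def by auto
  have inj: "inj_on g ?E"
  proof (rule inj_onI)
    fix \<mu> \<nu> assume E: "\<mu> \<in> ?E" "\<nu> \<in> ?E" and "g \<mu> = g \<nu>"
    then have "\<mu> *\<^sub>R g \<mu> = \<nu> *\<^sub>R g \<mu>"
      using g(2)[OF E(1)] g(2)[OF E(2)] by metis
    then show "\<mu> = \<nu>" using g(1)[OF E(1)] by (metis scaleR_cancel_right)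
  qed
  have "pairwise orthogonal (g ` ?E)"
  proof (rule pairwiseI)
    fix x y assume "x \<in> g ` ?E" "y \<in> g ` ?E" "x \<noteq> y"
    then obtain \<mu> \<nu> where E: "\<mu> \<in> ?E" "\<nu> \<in> ?E" and xy: "x = g \<mu>" "y = g \<nu>" and "\<mu> \<noteq> \<nu>"
      by blast
    have "g \<mu> \<bullet> (A *v g \<nu>) = (A *v g \<mu>) \<bullet> g \<nu>"
      by (metis dot_lmul_matrix sym transpose_matrix_vector)
    then have "\<nu> * (g \<mu> \<bullet> g \<nu>) = \<mu> * (g \<mu> \<bullet> g \<nu>)"
      by (simp add: g(2)[OF E(1)] g(2)[OF E(2)])
    then show "orthogonal x y"
      using \<open>\<mu> \<noteq> \<nu>\<close> by (simp add: orthogonal_def xy)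
  qed
  moreover have "0 \<notin> g ` ?E" using g(1) by force
  ultimately have "finite (g ` ?E)"
    by (intro independent_imp_finite pairwise_orthogonal_independent)
  then show ?thesis using inj by (rule finite_imageD)
qed

lemma finite_singular_values: "finite (singular_values A)"
proof -
  have "singular_values A =
      sqrt ` {\<mu>. \<exists>v. v \<noteq> 0 \<and> (transpose A ** A) *v v = \<mu> *\<^sub>R v}"
    by (auto simp: singular_values_def)
  then show ?thesis
    by (simp add: finite_symmetric_eigenvalues matrix_transpose_mul)
qed

text \<open>The least Rayleigh value \<open>m\<close> is an eigenvalue and nonnegative by
  semidefiniteness, so \<open>m = sqrt (m\<^sup>2)\<close> is itself a singular value and bounds
  \<open>sigma_min X\<close> from above.\<close>

lemma sigma_min_le_form:
  fixes X :: "real ^ 'n ^ 'n"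
  assumes sym: "transpose X = X" and psd: "\<And>x. 0 \<le> x \<bullet> (X *v x)"
  shows "sigma_min X * (x \<bullet> x) \<le> x \<bullet> (X *v x)"
proof -
  obtain v m where v: "v \<noteq> 0" "X *v v = m *\<^sub>R v" and m: "\<And>x. m * (x \<bullet> x) \<le> x \<bullet> (X *v x)"
    using symmetric_rayleigh_minimizer[OF sym] by metis
  have "0 \<le> m * (v \<bullet> v)" using psd[of v] by (simp add: v(2))
  moreover have "0 < v \<bullet> v" using v(1) by simp
  ultimately have "0 \<le> m" by (simp add: zero_le_mult_iff)
  have "(transpose X ** X) *v v = (m\<^sup>2) *\<^sub>R v"
    by (simp add: sym v(2) matrix_vector_mult_scaleR power2_eq_square
        flip: matrix_vector_mul_assoc)
  then have "sqrt (m\<^sup>2) \<in> singular_values X"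
    unfolding singular_values_def using v(1) by blast
  then have "sigma_min X \<le> m"
    unfolding sigma_min_def using \<open>0 \<le> m\<close> by (intro Min_le finite_singular_values) simp
  then have "sigma_min X * (x \<bullet> x) \<le> m * (x \<bullet> x)" by (simp add: mult_right_mono)
  then show ?thesis using m[of x] by linarith
qed

lemma form_le_spectral_norm: "x \<bullet> (W *v x) \<le> spectral_norm W * (x \<bullet> x)"
proof -
  have "x \<bullet> (W *v x) \<le> norm x * norm (W *v x)" by (rule norm_cauchy_schwarz)
  also have "\<dots> \<le> norm x * (spectral_norm W * norm x)"
    unfolding spectral_norm_def
    by (intro mult_left_mono onorm matrix_vector_mul_bounded_linear norm_ge_zero)
  finally show ?thesis by (simp add: dot_square_norm power2_eq_square mult_ac)
qed

text \<open>Splits \<open>D \<bullet> (A ** D)\<close> into vector quadratic forms on the columns of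
  \<open>D\<close>, so that spectral bounds on vectors carry over to the Frobenius inner
  product.\<close>

lemma inner_matrix_eq_sum_columns:
  fixes D E :: "real ^ 'r ^ 'n"
  shows "D \<bullet> E = (\<Sum>k\<in>UNIV. column k D \<bullet> column k E)"
  by (simp add: inner_vec_def column_def) (rule sum.swap)

lemma column_matrix_mult: "column k (A ** D) = A *v column k D"
  by (simp add: vec_eq_iff column_def matrix_matrix_mult_def matrix_vector_mult_def)

lemma matrix_diff_mult_distrib:
  fixes A B :: "real ^ 'm ^ 'n" and C :: "real ^ 'r ^ 'm"
  shows "(A - B) ** C = A ** C - B ** C"
  by (simp add: vec_eq_iff matrix_matrix_mult_def algebra_simps sum_subtractf)

lemma matrix_mult_diff_distrib:
  fixes A :: "real ^ 'm ^ 'n" and B C :: "real ^ 'r ^ 'm"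
  shows "A ** (B - C) = A ** B - A ** C"
  by (simp add: vec_eq_iff matrix_matrix_mult_def algebra_simps sum_subtractf)

lemma transpose_diff: "transpose (A - B) = transpose A - transpose (B :: real ^ 'm ^ 'n)"
  by (simp add: vec_eq_iff transpose_def)

text \<open>Mixed products of \<open>U\<close> and \<open>V\<close> collapse to
  \<open>W \<bullet> W\<close> or \<open>W \<bullet> transpose W\<close>. The pure terms
  \<open>U \<bullet> (W ** U)\<close> and \<open>V \<bullet> (W ** V)\<close> match those of
  \<open>D \<bullet> (W ** D)\<close>, and what remains is the skew part of
  \<open>W\<close>.\<close>

lemma inner_cross_terms:
  fixes U V :: "real ^ 'r ^ 'n"
  defines "W \<equiv> U ** transpose V" and "D \<equiv> U - V"
  shows "D \<bullet> (W ** V - transpose W ** U) = (norm (W - transpose W))\<^sup>2 / 2 - D \<bullet> (W ** D)"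
proof -
  have tW: "transpose W = V ** transpose U"
    by (simp add: W_def matrix_transpose_mul)
  have tr: "transpose W \<bullet> B = W \<bullet> transpose B" for B
    using inner_transpose_transpose[of W "transpose B"] by simp
  have "U \<bullet> (W ** V) = W \<bullet> W"
    using inner_mult_transpose[of W U V] by (simp flip: W_def)
  moreover have "V \<bullet> (W ** U) = W \<bullet> transpose W"
    using inner_mult_transpose[of W V U] by (simp flip: tW)
  moreover have "V \<bullet> (transpose W ** U) = W \<bullet> W"
    using inner_mult_transpose[of "transpose W" V U]
    by (simp add: inner_transpose_transpose flip: tW)
  moreover have "U \<bullet> (transpose W ** U) = U \<bullet> (W ** U)"
    using inner_mult_transpose[of "transpose W" U U] inner_mult_transpose[of W U U]
    by (simp add: tr matrix_transpose_mul)
  moreover have "(norm (W - transpose W))\<^sup>2 = 2 * (W \<bullet> W) - 2 * (W \<bullet> transpose W)"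
    by (simp add: power2_norm_eq_inner inner_diff_left inner_diff_right tr)
  ultimately show ?thesis
    unfolding D_def by (simp add: matrix_mult_diff_distrib inner_diff_left inner_diff_right field_simps)
qed

lemma subdiff_delta_plus_nonneg_mat: "S \<in> subdiff_delta_plus U \<Longrightarrow> nonneg_mat U"
  by (simp add: subdiff_delta_plus_def split: if_splits)

lemma subdiff_delta_plus_inner_le:
  assumes "S \<in> subdiff_delta_plus U" "nonneg_mat U'"
  shows "S \<bullet> (U' - U) \<le> 0"
proof -
  have "delta_plus U' \<ge> delta_plus U + ereal (S \<bullet> (U' - U))"
    using assms(1) by (simp add: subdiff_delta_plus_def split: if_splits)
  then show ?thesis
    using assms(2) subdiff_delta_plus_nonneg_mat[OF assms(1)]
    by (simp add: delta_plus_def flip: zero_ereal_def)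
qed

theorem theorem1:
  fixes X :: "real ^ 'n ^ 'n" and U V :: "real ^ 'r ^ 'n" and lam :: real
  assumes "transpose X = X"
    and "\<forall>x. 0 \<le> x \<bullet> (X *v x)"
    and "lam > 0"
    and "critical_point X lam U V"
    and "spectral_norm (U ** transpose V) < 2 * lam + sigma_min X"
  shows "U = V \<and> sym_critical_point X U"
proof -
  define W where "W = U ** transpose V"
  define D where "D = U - V"
  obtain S T where S: "S \<in> subdiff_delta_plus U" "0 = (W - X) ** V + lam *\<^sub>R D + S"
    and T: "T \<in> subdiff_delta_plus V" "0 = transpose (W - X) ** U - lam *\<^sub>R D + T"
    using assms(4) unfolding critical_point_def partial_U_def partial_V_def W_def D_def by blast
  \<comment> \<open>Each factor is a feasible test point for the other's condition, since a nonempty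
    subdifferential forces nonnegativity.\<close>
  have "S \<bullet> (V - U) \<le> 0" "T \<bullet> (U - V) \<le> 0"
    using S(1) T(1) subdiff_delta_plus_inner_le subdiff_delta_plus_nonneg_mat by blast+
  then have "D \<bullet> (T - S) \<le> 0"
    by (simp add: D_def inner_diff_left inner_diff_right inner_commute)
  \<comment> \<open>Symmetry of \<open>X\<close> merges the two data terms into
    \<open>X ** D\<close>; the two penalty terms add up.\<close>
  also have "T - S = (W ** V - transpose W ** U) + X ** D + (2 * lam) *\<^sub>R D"
  proof -
    have "S = - ((W - X) ** V + lam *\<^sub>R D)" "T = - (transpose (W - X) ** U - lam *\<^sub>R D)"
      using S(2) T(2) by (metis add.commute eq_neg_iff_add_eq_0)+
    moreover have "(2 * lam) *\<^sub>R D = lam *\<^sub>R D + lam *\<^sub>R D"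
      by (simp flip: scaleR_left_distrib)
    moreover have "X ** D = X ** U - X ** V"
      by (simp add: D_def matrix_mult_diff_distrib)
    ultimately show ?thesis
      by (simp add: matrix_diff_mult_distrib transpose_diff assms(1))
  qed
  finally have "D \<bullet> (W ** V - transpose W ** U) + D \<bullet> (X ** D) + 2 * lam * (D \<bullet> D) \<le> 0"
    by (simp add: inner_add_right)
  \<comment> \<open>The skew part enters as a nonnegative square and is dropped.\<close>
  moreover have "- (D \<bullet> (W ** D)) \<le> D \<bullet> (W ** V - transpose W ** U)"
    unfolding W_def D_def inner_cross_terms by simp
  moreover have "D \<bullet> (W ** D) \<le> spectral_norm W * (D \<bullet> D)"
    unfolding inner_matrix_eq_sum_columns[of D] column_matrix_mult sum_distrib_left
    by (intro sum_mono form_le_spectral_norm)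
  moreover have "sigma_min X * (D \<bullet> D) \<le> D \<bullet> (X ** D)"
    unfolding inner_matrix_eq_sum_columns[of D] column_matrix_mult sum_distrib_left
    using assms(1,2) by (intro sum_mono sigma_min_le_form) auto
  ultimately have "(2 * lam + sigma_min X - spectral_norm W) * (D \<bullet> D) \<le> 0"
    by (simp add: algebra_simps)
  moreover have "0 < 2 * lam + sigma_min X - spectral_norm W"
    using assms(5) by (simp add: W_def)
  ultimately have "D \<bullet> D \<le> 0" by (simp add: mult_le_0_iff)
  then have "D = 0" using inner_ge_zero[of D] by (metis inner_eq_zero_iff order.antisym)
  then have "U = V" by (simp add: D_def)
  \<comment> \<open>With \<open>D = 0\<close> the penalty term vanishes, and the condition for
    \<open>U\<close> is the symmetric one with the same \<open>S\<close>.\<close>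
  moreover from this have "sym_critical_point X U"
    using S unfolding sym_critical_point_def W_def \<open>D = 0\<close> by auto
  ultimately show ?thesis ..
qed

end
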